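(* Let $\mathcal{V}=\mathcal{C}_{N,k}$ be the approximation space and $\mathcal{W}=\mathcal{D}_{N,2k-2}$ the double-grid space, with $V=\dim\mathcal{V}$. Let $M:\Omega\to\mathbb{R}^{d\times d}$ be an integrable, uniformly positive definite and bounded matrix function, and let $\mathsf{A}\in\mathbb{R}^{V\times V}$ be the system matrix of the scalar elliptic problem, $$\mathsf{A}_{ij}=\int_\Omega M(x)\nabla\phi_{\mathcal{V}}^j(x)\cdot\nabla\phi_{\mathcal{V}}^i(x)\,dx.$$ For each element $T\in\mathcal{M}$ define $\mathsf{A}_T^{\mathrm{DoGIP}}\in\mathbb{R}^{d\times d\times W_T\times W_T}$, and define $\hat{\mathsf{B}}\in\mathbb{R}^{d\times W_T\times V_T}$ (independent of $T$), by $$\mathsf{A}^{\mathrm{DoGIP}}_{T,rsij}=\delta_{ij}\sum_{p,q=1}^d (R_T^{-1})_{rp}\,(R_T^{-1})_{sq}\int_T M_{pq}(x)\,\phi_{\mathcal{W}}^{l_T^{\mathcal{W}}(i)}(x)\,dx,\qquad \hat{\mathsf{B}}_{rik}=\frac{\partial\hat\phi_{\mathcal{V}}^k(\hat x_{\mathcal{W}}^i)}{\partial\hat x_r}.$$ Then for all $\mathsf{u},\mathsf{v}\in\mathbb{R}^V$, $$\mathsf{A}\mathsf{u}\cdot\mathsf{v}=\sum_{T\in\mathcal{M}}\hat{\mathsf{B}}^*\mathsf{A}_T^{\mathrm{DoGIP}}\hat{\mathsf{B}}\,\mathsf{u}_T\cdot\mathsf{v}_T,$$ where $\mathsf{u}_{T,l}=\mathsf{u}_{l_T^{\mathcal{V}}(l)}$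 and $\mathsf{v}_{T,k}=\mathsf{v}_{l_T^{\mathcal{V}}(k)}$ are the local degrees of freedom on $T$, and the element-level forms are evaluated as $$\hat{\mathsf{B}}^*\mathsf{A}_T^{\mathrm{DoGIP}}\hat{\mathsf{B}}\,\mathsf{u}_T\cdot\mathsf{v}_T=\sum_{r,s=1}^d\sum_{i,j=1}^{W_T}\sum_{k,l=1}^{V_T}\mathsf{A}^{\mathrm{DoGIP}}_{T,rsij}\,\hat{\mathsf{B}}_{sjl}\,\mathsf{u}_{T,l}\,\hat{\mathsf{B}}_{rik}\,\mathsf{v}_{T,k}$$ (the $k$ appearing as an index of arrays and functions is a running index, not the polynomial order).
   Context: $\Omega\subset\mathbb{R}^d$ ($d=2$ or $3$) is a bounded open set with a finite mesh $\mathcal{M}=\mathcal{M}(\Omega)$ of non-overlapping simplexes $T$ (triangles or tetrahedra) covering $\Omega$, with no hanging nodes (a conforming simplicial mesh). The subscript $N$ is the discretisation parameter of the mesh. $\mathcal{P}_k$ is the space of real polynomials on $\mathbb{R}^d$ of total degree at most $k$, and $k\ge1$ is an integer. Define $$\mathcal{C}_{N,\ell}=\{v:\Omega\to\mathbb{R}\mid v|_T\in\mathcal{P}_\ell\ \forall T\in\mathcal{M},\ v\text{ continuous}\},\qquad \mathcal{D}_{N,\ell}=\{v:\Omega\to\mathbb{R}\mid v|_T\in\mathcal{P}_\ell\ \forall T\in\mathcal{M}\},$$ where functions in $\mathcal{D}_{N,\ell}$ may jump across element boundaries: restrictions are to element interiors, and values on facets are disregarded. Each such space $\mathcal{X}$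 is equipped with its standard Lagrange finite element basis $\phi_{\mathcal{X}}^i$ and nodal points $x_{\mathcal{X}}^i$, $i=1,\dots,\dim\mathcal{X}$, with $\phi_{\mathcal{X}}^j(x_{\mathcal{X}}^i)=\delta_{ij}$. For $\mathcal{D}_{N,\ell}$ each basis function $\phi^i$ is supported on a single element $T_i$ (and zero elsewhere), its node lies in the closure of $T_i$, and the value at the $i$-th node of an element-wise polynomial function is the continuous extension from $T_i$. Thus nodes of different elements that coincide geometrically are treated as distinct nodes. Gradients are taken element-wise. Reference element: each $T$ is the image of a fixed reference simplex $\hat T$ under an affine map $F_T(\hat x)=R_T\hat x+S_T$ with $R_T\in\mathbb{R}^{d\times d}$ invertible and $S_T\in\mathbb{R}^d$. For a space $\mathcal{X}$ of polynomial order $\ell$ let $X_T=\dim\mathcal{P}_\ell$ (so $V_T=\dim\mathcal{P}_k$ and $W_T=\dim\mathcal{P}_{2k-2}$). On $\hat T$ there are reference Lagrange shape functions $\hat\phi_{\mathcal{X}}^1,\dots,\hat\phi_{\mathcal{X}}^{X_T}$ forming a basis of $\mathcal{P}_\ell$ and reference nodes $\hat x_{\mathcal{X}}^1,\dots,\hat x_{\mathcal{X}}^{X_T}$ with $\hat\phi_{\mathcal{X}}^j(\hat x_{\mathcal{X}}^i)=\delta_{ij}$. For each $T$ there is an injective local-to-global index map $l_T^{\mathcal{X}}:\{1,\dots,X_T\}\to\{1,\dots,\dim\mathcal{X}\}$ such that $\phi_{\mathcal{X}}^{l_T^{\mathcal{X}}(i)}(x)=\hat\phi_{\mathcal{X}}^i(F_T^{-1}(x))$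 for $x\in T$ and $x_{\mathcal{X}}^{l_T^{\mathcal{X}}(i)}=F_T(\hat x_{\mathcal{X}}^i)$, while global basis functions with index outside the range of $l_T^{\mathcal{X}}$ vanish on $T$. Uniform positive definiteness and boundedness of $M$ means that there are constants $c,C\in\mathbb{R}$ with $0<c\le\frac{M(x)y\cdot y}{\|y\|^2}\le C$ for all $x\in\Omega$ and all nonzero $y\in\mathbb{R}^d$. $\hat{\mathsf{B}}$ acts by $(\hat{\mathsf{B}}\mathsf{u}_T)_{sj}=\sum_l\hat{\mathsf{B}}_{sjl}\mathsf{u}_{T,l}$, $\mathsf{A}_T^{\mathrm{DoGIP}}$ acts by $(\mathsf{A}_T^{\mathrm{DoGIP}}\mathsf{w})_{ri}=\sum_{s,j}\mathsf{A}^{\mathrm{DoGIP}}_{T,rsij}\mathsf{w}_{sj}$, and $\hat{\mathsf{B}}^*$ is the adjoint of $\hat{\mathsf{B}}$ with respect to the Euclidean inner products. *)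

theory Defs
  imports "HOL-Analysis.Analysis" "HOL-Library.Function_Algebras"
begin

section \<open>Polynomial spaces\<close>

definition scale_fun :: "real \<Rightarrow> ('a \<Rightarrow> real) \<Rightarrow> 'a \<Rightarrow> real" where
  "scale_fun c f = (\<lambda>x. c * f x)"

interpretation funsp: vector_space "scale_fun :: real \<Rightarrow> ('a \<Rightarrow> real) \<Rightarrow> 'a \<Rightarrow> real"
  by unfold_locales (auto simp: scale_fun_def algebra_simps fun_eq_iff)

definition basis_family :: "('i \<Rightarrow> 'a \<Rightarrow> real) \<Rightarrow> ('a \<Rightarrow> real) set \<Rightarrow> bool" where
  "basis_family \<phi> X \<longleftrightarrow>
     inj \<phi> \<and> funsp.independent (range \<phi>) \<and> funsp.span (range \<phi>) = X"

definition poly_space :: "nat \<Rightarrow> (real^'d \<Rightarrow> real) set" where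
  "poly_space l = funsp.span
     {(\<lambda>x. \<Prod>i\<in>UNIV. (x $ i) ^ \<alpha> i) | \<alpha> :: 'd \<Rightarrow> nat. (\<Sum>i\<in>UNIV. \<alpha> i) \<le> l}"


section \<open>Meshes and piecewise polynomial spaces\<close>

text \<open>
  Elements are closed simplexes. A triangulation requires any two elements to meet in a common
  (possibly empty) face, so full-dimensional elements do not overlap and there are no hanging nodes.
  Since \<open>\<Omega>\<close> is open, elements need not be contained in it, but their interiors are.
\<close>

definition conforming_mesh :: "(real^'d) set \<Rightarrow> (real^'d) set set \<Rightarrow> bool" where
  "conforming_mesh \<Omega> \<M> \<longleftrightarrow>
     triangulation \<M> \<and>
     (\<forall>T\<in>\<M>. int CARD('d) simplex T \<and> interior T \<subseteq> \<Omega>) \<and>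
     \<Omega> \<subseteq> \<Union>\<M>"

text \<open>
  Functions on \<open>\<Omega>\<close> are represented by their extension by zero. The values of broken functions on
  facets carry no information, so the representative is taken to be zero there; this makes
  equality of functions agree with equality on all element interiors.
\<close>

definition cont_pw_poly :: "(real^'d) set \<Rightarrow> (real^'d) set set \<Rightarrow> nat \<Rightarrow> (real^'d \<Rightarrow> real) set" where
  "cont_pw_poly \<Omega> \<M> l = {v.
     (\<forall>T\<in>\<M>. \<exists>p\<in>poly_space l. \<forall>x\<in>interior T. v x = p x) \<and>
     continuous_on \<Omega> v \<and>
     (\<forall>x. x \<notin> \<Omega> \<longrightarrow> v x = 0)}"

definition broken_pw_poly :: "(real^'d) set set \<Rightarrow> nat \<Rightarrow> (real^'d \<Rightarrow> real) set" where
  "broken_pw_poly \<M> l = {v.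
     (\<forall>T\<in>\<M>. \<exists>p\<in>poly_space l. \<forall>x\<in>interior T. v x = p x) \<and>
     (\<forall>x. x \<notin> (\<Union>T\<in>\<M>. interior T) \<longrightarrow> v x = 0)}"


section \<open>Lagrange bases\<close>

definition affine_map :: "real^'d^'d \<Rightarrow> real^'d \<Rightarrow> real^'d \<Rightarrow> real^'d" where
  "affine_map R S x = R *v x + S"

definition affine_mesh_maps ::
  "(real^'d) set set \<Rightarrow> (real^'d) set \<Rightarrow> ((real^'d) set \<Rightarrow> real^'d^'d) \<Rightarrow>
    ((real^'d) set \<Rightarrow> real^'d) \<Rightarrow> bool" where
  "affine_mesh_maps \<M> That R S \<longleftrightarrow>
     int CARD('d) simplex That \<and>
     (\<forall>T\<in>\<M>. invertible (R T) \<and> T = affine_map (R T) (S T) ` That)"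

definition reference_lagrange ::
  "(real^'d) set \<Rightarrow> nat \<Rightarrow> ('m \<Rightarrow> real^'d \<Rightarrow> real) \<Rightarrow> ('m \<Rightarrow> real^'d) \<Rightarrow> bool" where
  "reference_lagrange That l \<phi>hat xhat \<longleftrightarrow>
     basis_family \<phi>hat (poly_space l) \<and>
     (\<forall>i. xhat i \<in> That) \<and>
     (\<forall>i j. \<phi>hat j (xhat i) = (if i = j then 1 else 0))"

text \<open>
  The last conjunct below is the nodal property \<open>\<phi> j (x i) = \<delta>\<^sub>i\<^sub>j\<close>. A node may lie on the boundary
  of an element, or of \<open>\<Omega>\<close>, so the value there is the continuous extension from the interior of
  an element to which the index \<open>i = loc T m\<close> belongs.
\<close>

definition lagrange_basis ::
  "(real^'d) set set \<Rightarrow> ((real^'d) set \<Rightarrow> real^'d^'d) \<Rightarrow> ((real^'d) set \<Rightarrow> real^'d) \<Rightarrow>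
    ('m \<Rightarrow> real^'d \<Rightarrow> real) \<Rightarrow> ('m \<Rightarrow> real^'d) \<Rightarrow>
    (real^'d \<Rightarrow> real) set \<Rightarrow> ('i \<Rightarrow> real^'d \<Rightarrow> real) \<Rightarrow> ('i \<Rightarrow> real^'d) \<Rightarrow>
    ((real^'d) set \<Rightarrow> 'm \<Rightarrow> 'i) \<Rightarrow> bool" where
  "lagrange_basis \<M> R S \<phi>hat xhat X \<phi> x loc \<longleftrightarrow>
     basis_family \<phi> X \<and>
     (\<forall>T\<in>\<M>.
        inj (loc T) \<and>
        (\<forall>m. x (loc T m) = affine_map (R T) (S T) (xhat m)) \<and>
        (\<forall>m. \<forall>y\<in>interior T. \<phi> (loc T m) y = \<phi>hat m (inv (affine_map (R T) (S T)) y)) \<and>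
        (\<forall>j. j \<notin> range (loc T) \<longrightarrow> (\<forall>y\<in>interior T. \<phi> j y = 0)) \<and>
        (\<forall>m j. (\<phi> j \<longlongrightarrow> (if loc T m = j then 1 else 0)) (at (x (loc T m)) within interior T)))"

definition single_element_support ::
  "(real^'d) set set \<Rightarrow> ('i \<Rightarrow> real^'d \<Rightarrow> real) \<Rightarrow> ('i \<Rightarrow> real^'d) \<Rightarrow> bool" where
  "single_element_support \<M> \<phi> x \<longleftrightarrow>
     (\<forall>i. \<exists>T\<in>\<M>. x i \<in> T \<and> (\<forall>T'\<in>\<M>. T' \<noteq> T \<longrightarrow> (\<forall>y\<in>interior T'. \<phi> i y = 0)))"


section \<open>The system matrix and its element-wise decomposition\<close>

definition uniformly_posdef_bounded :: "(real^'d) set \<Rightarrow> (real^'d \<Rightarrow> real^'d^'d) \<Rightarrow> bool" where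
  "uniformly_posdef_bounded \<Omega> M \<longleftrightarrow>
     (\<exists>c C. 0 < c \<and>
        (\<forall>x\<in>\<Omega>. \<forall>y. y \<noteq> 0 \<longrightarrow>
           c \<le> ((M x *v y) \<bullet> y) / (norm y)\<^sup>2 \<and> ((M x *v y) \<bullet> y) / (norm y)\<^sup>2 \<le> C))"

definition partial_deriv :: "'d \<Rightarrow> (real^'d \<Rightarrow> real) \<Rightarrow> real^'d \<Rightarrow> real" where
  "partial_deriv r f x = frechet_derivative f (at x) (axis r 1)"

text \<open>The element-wise gradient; it is set to zero on the null set of facets.\<close>

definition elem_grad :: "(real^'d) set set \<Rightarrow> (real^'d \<Rightarrow> real) \<Rightarrow> real^'d \<Rightarrow> real^'d" where
  "elem_grad \<M> f x =
     (if x \<in> (\<Union>T\<in>\<M>. interior T) then (\<chi> p. partial_deriv p f x) else 0)"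

text \<open>Integrals are with respect to the completed measure \<^term>\<open>lebesgue\<close>.\<close>

definition system_matrix ::
  "(real^'d) set \<Rightarrow> (real^'d) set set \<Rightarrow> (real^'d \<Rightarrow> real^'d^'d) \<Rightarrow>
    ('v::finite \<Rightarrow> real^'d \<Rightarrow> real) \<Rightarrow> real^'v^'v" where
  "system_matrix \<Omega> \<M> M \<phi> =
     (\<chi> i j. LINT x:\<Omega>|lebesgue. (M x *v elem_grad \<M> (\<phi> j) x) \<bullet> elem_grad \<M> (\<phi> i) x)"

text \<open>
  Below, \<open>A $ r $ s $ i $ j\<close> and \<open>B $ r $ i $ k\<close> are the tensor entries with indices \<open>rsij\<close>
  and \<open>rik\<close>; the vector type constructors nest in the reverse order.
\<close>

definition dogip_tensor ::
  "((real^'d) set \<Rightarrow> real^'d^'d) \<Rightarrow> (real^'d \<Rightarrow> real^'d^'d) \<Rightarrow> ('w \<Rightarrow> real^'d \<Rightarrow> real) \<Rightarrow>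
    ((real^'d) set \<Rightarrow> 'wt::finite \<Rightarrow> 'w) \<Rightarrow> (real^'d) set \<Rightarrow> real^'wt^'wt^'d^'d" where
  "dogip_tensor R M \<phi>W locW T =
     (\<chi> r s i j. if i = j then
        (\<Sum>p\<in>UNIV. \<Sum>q\<in>UNIV.
           matrix_inv (R T) $ r $ p * matrix_inv (R T) $ s $ q *
           (LINT x:T|lebesgue. M x $ p $ q * \<phi>W (locW T i) x))
      else 0)"

definition dogip_B ::
  "('vt::finite \<Rightarrow> real^'d \<Rightarrow> real) \<Rightarrow> ('wt::finite \<Rightarrow> real^'d) \<Rightarrow> real^'vt^'wt^'d" where
  "dogip_B \<phi>hatV xhatW = (\<chi> r i k. partial_deriv r (\<phi>hatV k) (xhatW i))"

definition apply_B :: "real^'vt^'wt^'d \<Rightarrow> real^'vt \<Rightarrow> real^'wt^'d" where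
  "apply_B B u = (\<chi> s j. \<Sum>l\<in>UNIV. B $ s $ j $ l * u $ l)"

definition apply_A :: "real^'wt^'wt^'d^'d \<Rightarrow> real^'wt^'d \<Rightarrow> real^'wt^'d" where
  "apply_A A w = (\<chi> r i. \<Sum>s\<in>UNIV. \<Sum>j\<in>UNIV. A $ r $ s $ i $ j * w $ s $ j)"

definition local_dofs ::
  "((real^'d) set \<Rightarrow> 'vt::finite \<Rightarrow> 'v::finite) \<Rightarrow> (real^'d) set \<Rightarrow> real^'v \<Rightarrow> real^'vt" where
  "local_dofs locV T u = (\<chi> l. u $ locV T l)"

end

theory Submission
  imports Defs
begin

text \<open>
  On an element \<open>T\<close>, global basis functions are reference shape functions composed with the inverse
  of the affine map \<open>F\<^sub>T\<close>. By the chain rule, \<open>M \<nabla>\<phi>\<^sub>l \<bullet> \<nabla>\<phi>\<^sub>k\<close> on \<open>T\<close> is therefore a sum of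
  products \<open>\<partial>\<^sub>s \<phi>hat\<^sub>l \<partial>\<^sub>r \<phi>hat\<^sub>k\<close> of reference derivatives, weighted by entries of \<open>M\<close> and by constants
  built from \<open>R\<^sub>T\<^sup>-\<^sup>1\<close>. Each factor is a polynomial of degree at most \<open>k - 1\<close>, so the product has degree
  at most \<open>2 k - 2\<close> and is reproduced exactly by Lagrange interpolation in the double-grid shape
  functions (\<open>derivative_product_interpolation\<close>). The nodal values in this interpolation are products
  of entries of \<open>B\<close>; what remains under the integral is an entry of \<open>M\<close> times a double-grid basis
  function, and these integrals with the \<open>R\<^sub>T\<^sup>-\<^sup>1\<close> weights are the entries of the DoGIP tensor. No quadrature error occurs, whatever the
  coefficient \<open>M\<close> is. This gives the element identity \<open>element_stiffness\<close>.

  The global identity is the sum of the element identities. The element-wise gradient and the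
  broken basis functions vanish off the element interiors, and distinct interiors are disjoint, so
  the integral over \<open>\<Omega>\<close> splits exactly into integrals over interiors
  (\<open>system_matrix_eq_sum_elements\<close>); on each element only the local degrees of freedom contribute
  (\<open>elem_grad_nonlocal\<close>).
\<close>

section \<open>Polynomial spaces and Lagrange interpolation\<close>

lemma monomial_in_poly_space:
  assumes "(\<Sum>i\<in>UNIV. \<alpha> i) \<le> l"
  shows "(\<lambda>x::real^'d. \<Prod>i\<in>UNIV. (x $ i) ^ \<alpha> i) \<in> poly_space l"
  unfolding poly_space_def by (rule funsp.span_base) (use assms in auto)

lemma poly_space_zero: "(\<lambda>x. 0) \<in> poly_space l"
  using funsp.span_zero[of "{(\<lambda>x::real^'d. \<Prod>i\<in>UNIV. (x $ i) ^ \<alpha> i) | \<alpha> :: 'd \<Rightarrow> nat. (\<Sum>i\<in>UNIV. \<alpha> i) \<le> l}"]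
  unfolding poly_space_def zero_fun_def by simp

lemma poly_space_add:
  "f \<in> poly_space l \<Longrightarrow> g \<in> poly_space l \<Longrightarrow> (\<lambda>x. f x + g x) \<in> poly_space l"
  using funsp.span_add[of f _ g] unfolding poly_space_def plus_fun_def by blast

lemma poly_space_scale: "f \<in> poly_space l \<Longrightarrow> (\<lambda>x. c * f x) \<in> poly_space l"
  using funsp.span_scale[of f _ c] unfolding poly_space_def scale_fun_def by blast

lemma poly_space_induct [consumes 1, case_names zero add scale monomial]:
  fixes P :: "(real^'d \<Rightarrow> real) \<Rightarrow> bool"
  assumes "f \<in> poly_space l"
    and zero: "P (\<lambda>x. 0)"
    and add: "\<And>f g. P f \<Longrightarrow> P g \<Longrightarrow> P (\<lambda>x. f x + g x)"
    and scale: "\<And>c f. P f \<Longrightarrow> P (\<lambda>x. c * f x)"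
    and monomial: "\<And>\<alpha>. (\<Sum>i\<in>UNIV. \<alpha> i) \<le> l \<Longrightarrow> P (\<lambda>x. \<Prod>i\<in>UNIV. (x $ i) ^ \<alpha> i)"
  shows "P f"
  using assms(1) unfolding poly_space_def
proof (induction rule: funsp.span_induct)
  case base
  show ?case
    using zero add scale
    by (auto simp: funsp.subspace_def zero_fun_def plus_fun_def scale_fun_def)
next
  case (step f)
  then show ?case using monomial by blast
qed

lemma poly_space_mult:
  fixes f g :: "real^'d \<Rightarrow> real"
  assumes "f \<in> poly_space a" "g \<in> poly_space b"
  shows "(\<lambda>x. f x * g x) \<in> poly_space (a + b)"
  using assms(1)
proof (induction rule: poly_space_induct)
  case (monomial \<alpha>)
  show ?case
    using assms(2)
  proof (induction rule: poly_space_induct)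
    case (monomial \<beta>)
    have "(\<lambda>x::real^'d. \<Prod>i\<in>UNIV. (x $ i) ^ (\<alpha> i + \<beta> i)) \<in> poly_space (a + b)"
      using monomial \<open>(\<Sum>i\<in>UNIV. \<alpha> i) \<le> a\<close>
      by (intro monomial_in_poly_space) (simp add: sum.distrib)
    then show ?case by (simp add: power_add prod.distrib)
  qed (auto simp: poly_space_zero distrib_left mult.left_commute
      intro: poly_space_add poly_space_scale)
qed (auto simp: poly_space_zero distrib_right mult.assoc
    intro: poly_space_add poly_space_scale)

lemma partial_deriv_eq:
  assumes "(f has_derivative D) (at x)"
  shows "partial_deriv r f x = D (axis r 1)"
  using frechet_derivative_at[OF assms] by (simp add: partial_deriv_def)

lemma monomial_has_derivative:
  fixes x :: "real^'d" and \<alpha> :: "'d \<Rightarrow> nat"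
  shows "((\<lambda>x. \<Prod>i\<in>UNIV. (x $ i) ^ \<alpha> i) has_derivative
           (\<lambda>y. \<Sum>i\<in>UNIV. (of_nat (\<alpha> i) * y $ i * (x $ i) ^ (\<alpha> i - 1)) *
                            (\<Prod>j\<in>UNIV - {i}. (x $ j) ^ \<alpha> j))) (at x)"
  by (rule has_derivative_prod)
    (auto intro!: has_derivative_eq_rhs[OF has_derivative_power
        [OF bounded_linear_imp_has_derivative[OF bounded_linear_vec_nth]]]
      simp: fun_eq_iff)

text \<open>
  A partial derivative lowers the total degree by one. This is what brings products of two first
  derivatives of degree-\<open>k\<close> shape functions into the double-grid space of order \<open>2 * k - 2\<close>.
\<close>

lemma poly_space_derivative:
  fixes f :: "real^'d \<Rightarrow> real"
  assumes "f \<in> poly_space l"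
  shows "(\<forall>x. f differentiable (at x)) \<and> (\<forall>r. partial_deriv r f \<in> poly_space (l - 1))"
  using assms
proof (induction rule: poly_space_induct)
  case zero
  have "partial_deriv r (\<lambda>x::real^'d. 0) = (\<lambda>x. 0)" for r
    by (rule ext, subst partial_deriv_eq) (auto intro: has_derivative_const)
  then show ?case by (simp add: poly_space_zero)
next
  case (add f g)
  have "partial_deriv r (\<lambda>x. f x + g x) = (\<lambda>x. partial_deriv r f x + partial_deriv r g x)" for r
  proof
    fix x
    have "(f has_derivative frechet_derivative f (at x)) (at x)"
      and "(g has_derivative frechet_derivative g (at x)) (at x)"
      using add frechet_derivative_works by blast+
    from has_derivative_add[OF this]
    show "partial_deriv r (\<lambda>x. f x + g x) x = partial_deriv r f x + partial_deriv r g x"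
      by (subst partial_deriv_eq) (auto simp: partial_deriv_def)
  qed
  then show ?case using add by (simp add: poly_space_add)
next
  case (scale c f)
  have "partial_deriv r (\<lambda>x. c * f x) = (\<lambda>x. c * partial_deriv r f x)" for r
  proof
    fix x
    have "(f has_derivative frechet_derivative f (at x)) (at x)"
      using scale frechet_derivative_works by blast
    from has_derivative_mult_right[OF this, of c]
    show "partial_deriv r (\<lambda>x. c * f x) x = c * partial_deriv r f x"
      by (subst partial_deriv_eq) (auto simp: partial_deriv_def)
  qed
  then show ?case using scale by (simp add: poly_space_scale)
next
  case (monomial \<alpha>)
  have "partial_deriv r (\<lambda>x. \<Prod>i\<in>UNIV. (x $ i) ^ \<alpha> i) \<in> poly_space (l - 1)" for r
  proof -
    \<comment> \<open>The exponent of the derivative; if \<open>\<alpha> r = 0\<close> the truncated subtraction makes it \<open>\<alpha>\<close>,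
      and the factor \<open>\<alpha> r\<close> annihilates the monomial.\<close>
    let ?\<beta> = "\<alpha>(r := \<alpha> r - 1)"
    have split: "(\<Prod>i\<in>UNIV. (x $ i) ^ ?\<beta> i)
        = (x $ r) ^ (\<alpha> r - 1) * (\<Prod>j\<in>UNIV - {r}. (x $ j) ^ \<alpha> j)" for x :: "real^'d"
      by (subst prod.remove[of _ r]) (auto intro!: prod.cong)
    have "partial_deriv r (\<lambda>x. \<Prod>i\<in>UNIV. (x $ i) ^ \<alpha> i) x
        = of_nat (\<alpha> r) * (\<Prod>i\<in>UNIV. (x $ i) ^ ?\<beta> i)" for x :: "real^'d"
      unfolding split
      by (subst partial_deriv_eq[OF monomial_has_derivative], subst sum.remove[of _ r])
        (auto simp: axis_def intro!: sum.neutral)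
    then have eq: "partial_deriv r (\<lambda>x. \<Prod>i\<in>UNIV. (x $ i) ^ \<alpha> i)
        = (\<lambda>x. of_nat (\<alpha> r) * (\<Prod>i\<in>UNIV. (x $ i) ^ ?\<beta> i))"
      by blast
    show ?thesis
    proof (cases "\<alpha> r = 0")
      case True
      then show ?thesis unfolding eq by (simp add: poly_space_zero)
    next
      case False
      have "sum ?\<beta> UNIV = \<alpha> r - 1 + sum \<alpha> (UNIV - {r})"
        by (subst sum.remove[of _ r]) (auto intro!: sum.cong)
      moreover have "sum \<alpha> UNIV = \<alpha> r + sum \<alpha> (UNIV - {r})"
        by (subst sum.remove[of _ r]) auto
      ultimately have "sum ?\<beta> UNIV \<le> l - 1"
        using False monomial by linarith
      then show ?thesis
        unfolding eq by (intro poly_space_scale monomial_in_poly_space)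
    qed
  qed
  then show ?case
    using monomial_has_derivative differentiableI by blast
qed

lemma poly_space_continuous: "f \<in> poly_space l \<Longrightarrow> continuous_on A f"
  by (meson continuous_at_imp_continuous_on differentiable_imp_continuous_within
      poly_space_derivative)

text \<open>
  The coefficients of \<open>f\<close> in a basis dual to the point evaluations at the nodes must be the nodal
  values of \<open>f\<close>. Both sides are linear in \<open>f\<close>, so it suffices to check the basis functions.
\<close>

lemma nodal_interpolation:
  fixes \<phi>hat :: "'m::finite \<Rightarrow> real^'d \<Rightarrow> real"
  assumes "reference_lagrange That l \<phi>hat xhat" and "f \<in> poly_space l"
  shows "f \<xi> = (\<Sum>i\<in>UNIV. f (xhat i) * \<phi>hat i \<xi>)"
proof -
  have "f \<in> funsp.span (range \<phi>hat)"
    using assms by (simp add: reference_lagrange_def basis_family_def)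
  then show ?thesis
  proof (induction rule: funsp.span_induct)
    case base
    show ?case
      by (auto simp: funsp.subspace_def zero_fun_def plus_fun_def scale_fun_def sum.distrib
          sum_distrib_left algebra_simps)
  next
    case (step g)
    then obtain j where g: "g = \<phi>hat j" by blast
    have "\<phi>hat j (xhat i) = (if i = j then 1 else 0)" for i
      using assms(1) by (simp add: reference_lagrange_def)
    then show ?case by (simp add: g if_distrib[of "\<lambda>c. c * _"] cong: if_cong)
  qed
qed

section \<open>Affine pull-back of gradients\<close>

lemma inv_affine_map:
  fixes R :: "real^'d^'d"
  assumes "invertible R"
  shows "inv (affine_map R S) = (\<lambda>y. matrix_inv R *v (y - S))"
proof -
  have "matrix_inv R ** R = mat 1" "R ** matrix_inv R = mat 1"
    using someI_ex[OF assms[unfolded invertible_def]] by (simp_all add: matrix_inv_def)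
  then show ?thesis
    by (intro inv_equality) (auto simp: affine_map_def matrix_vector_mul_assoc)
qed

text \<open>
  The chain rule \<open>\<nabla> (f \<circ> F\<^sub>T\<^sup>-\<^sup>1) = transpose R\<^sub>T\<^sup>-\<^sup>1 (\<nabla> f \<circ> F\<^sub>T\<^sup>-\<^sup>1)\<close>. Only the values of \<open>g\<close> on an open set enter,
  since global basis functions are pull-backs of shape functions on element interiors only.
\<close>

lemma partial_deriv_affine_pullback:
  fixes R :: "real^'d^'d" and S :: "real^'d" and f g :: "real^'d \<Rightarrow> real"
  assumes "invertible R" and "f differentiable (at (inv (affine_map R S) x))"
    and "open U" "x \<in> U" and "\<And>y. y \<in> U \<Longrightarrow> g y = f (inv (affine_map R S) y)"
  shows "partial_deriv p g x
    = (\<Sum>r\<in>UNIV. matrix_inv R $ r $ p * partial_deriv r f (inv (affine_map R S) x))"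
proof -
  let ?G = "inv (affine_map R S)"
  let ?D = "frechet_derivative f (at (?G x))"
  have D: "(f has_derivative ?D) (at (?G x))"
    using assms(2) frechet_derivative_works by blast
  then have lin: "linear ?D" using has_derivative_linear by blast
  have "(?G has_derivative (\<lambda>y. matrix_inv R *v y)) (at x)"
    unfolding inv_affine_map[OF assms(1)]
    by (auto intro!: derivative_eq_intros bounded_linear.has_derivative[OF matrix_vector_mul_bounded_linear])
  from has_derivative_compose[OF this D]
  have "((\<lambda>y. f (?G y)) has_derivative (\<lambda>y. ?D (matrix_inv R *v y))) (at x)" .
  then have "(g has_derivative (\<lambda>y. ?D (matrix_inv R *v y))) (at x)"
    by (rule has_derivative_transform_within_open[OF _ assms(3,4)]) (simp add: assms(5))
  then have "partial_deriv p g x = ?D (matrix_inv R *v axis p 1)"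
    by (rule partial_deriv_eq)
  also have "matrix_inv R *v axis p 1 = (\<Sum>r\<in>UNIV. (matrix_inv R $ r $ p) *\<^sub>R axis r 1)"
    by (subst basis_expansion[symmetric])
      (simp add: matrix_vector_mult_basis column_def scalar_mult_eq_scaleR)
  also have "?D \<dots> = (\<Sum>r\<in>UNIV. matrix_inv R $ r $ p * partial_deriv r f (?G x))"
    by (simp add: linear_sum[OF lin] linear_cmul[OF lin] partial_deriv_def)
  finally show ?thesis .
qed

section \<open>Element interiors of a conforming mesh\<close>

text \<open>
  If \<open>T\<close> reaches the interior of \<open>T'\<close>, the common face \<open>T \<inter> T'\<close> contains an interior point of \<open>T'\<close> and
  is therefore all of \<open>T'\<close>. Then \<open>x\<close> is interior to \<open>T\<close> too, and the roles can be exchanged.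
\<close>

lemma conforming_mesh_interior_meets:
  fixes \<Omega> :: "(real^'d) set"
  assumes mesh: "conforming_mesh \<Omega> \<M>" and "T \<in> \<M>" "T' \<in> \<M>" "x \<in> T" "x \<in> interior T'"
  shows "T = T'"
proof -
  have sub: "K' \<subseteq> K" if "K \<in> \<M>" "K' \<in> \<M>" "x \<in> K" "x \<in> interior K'" for K K'
  proof -
    have "(K' \<inter> K) face_of K'"
      using mesh that unfolding conforming_mesh_def triangulation_def
      by metis
    moreover have "\<not> disjnt (K' \<inter> K) (interior K')"
      using that interior_subset by (auto simp: disjnt_def)
    ultimately have "K' \<inter> K = K'"
      by (metis disjnt_def face_of_disjoint_interior)
    then show ?thesis by blast
  qed
  have "T' \<subseteq> T" using sub assms by blast
  then have "x \<in> interior T" using assms interior_mono by blast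
  then have "T \<subseteq> T'" using sub assms interior_subset by blast
  with \<open>T' \<subseteq> T\<close> show ?thesis by blast
qed

lemma elem_grad_interior:
  assumes "T \<in> \<M>" "x \<in> interior T"
  shows "elem_grad \<M> f x = (\<chi> p. partial_deriv p f x)"
  using assms by (auto simp: elem_grad_def)

text \<open>
  Splits integrands that vanish off the element interiors, such as those built from element-wise
  gradients: interiors lie in \<open>\<Omega>\<close> and are disjoint, so at most one summand is nonzero at \<open>x\<close>.
\<close>

lemma indicator_region_eq_sum_interiors:
  fixes \<Omega> :: "(real^'d) set"
  assumes mesh: "conforming_mesh \<Omega> \<M>"
    and zero: "x \<notin> (\<Union>T\<in>\<M>. interior T) \<Longrightarrow> f x = (0::real)"
  shows "indicator \<Omega> x * f x = (\<Sum>T\<in>\<M>. indicator (interior T) x * f x)"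
proof (cases "\<exists>T\<in>\<M>. x \<in> interior T")
  case True
  then obtain T where T: "T \<in> \<M>" "x \<in> interior T" by blast
  have fin: "finite \<M>" using mesh by (simp add: conforming_mesh_def triangulation_def)
  have "x \<in> \<Omega>" using T mesh by (auto simp: conforming_mesh_def)
  have "indicator (interior T') x * f x = (if T' = T then f x else 0)" if "T' \<in> \<M>" for T'
    using conforming_mesh_interior_meets[OF mesh that T(1)] T interior_subset
    by (auto simp: indicator_def)
  then have "(\<Sum>T'\<in>\<M>. indicator (interior T') x * f x) = f x"
    using fin T by simp
  then show ?thesis using \<open>x \<in> \<Omega>\<close> by simp
next
  case False
  then show ?thesis using zero by (simp add: indicator_def)
qed

section \<open>Exact integration on one element\<close>

text \<open>
  The entries of \<open>M\<close> are integrable but possibly unbounded; the continuous factor is bounded on the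
  compact closure of \<open>U\<close>, which gives an integrable majorant.
\<close>

lemma integrable_entry_times_continuous:
  fixes \<Omega> :: "(real^'d) set" and M :: "real^'d \<Rightarrow> real^'n^'m" and f :: "real^'d \<Rightarrow> real"
  assumes M: "set_integrable lebesgue \<Omega> M"
    and U: "open U" "bounded U" "U \<subseteq> \<Omega>" and f: "continuous_on UNIV f"
  shows "integrable lebesgue (\<lambda>x. indicator U x * (M x $ p $ q * f x))"
proof -
  have "compact (f ` closure U)"
    using U f by (intro compact_continuous_image continuous_on_subset[OF f]) (auto simp: compact_closure)
  then obtain C where C: "\<And>x. x \<in> closure U \<Longrightarrow> norm (f x) \<le> C"
    by (meson compact_imp_bounded bounded_iff imageI)
  have "bounded_linear (\<lambda>A::real^'n^'m. A $ p $ q)"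
    by (intro bounded_linear_compose[OF bounded_linear_vec_nth bounded_linear_vec_nth])
  then have "integrable lebesgue (\<lambda>x. (indicator \<Omega> x *\<^sub>R M x) $ p $ q)"
    using M unfolding set_integrable_def by (rule integrable_bounded_linear)
  then have I: "integrable lebesgue (\<lambda>x. indicator \<Omega> x * M x $ p $ q)" by simp
  have meas: "(\<lambda>x. indicator U x * f x) \<in> borel_measurable lebesgue"
    using U f by (intro measurable_completion borel_measurable_times borel_measurable_indicator)
      (auto intro: borel_measurable_continuous_onI)
  have eq: "indicator U x * (M x $ p $ q * f x)
      = (indicator \<Omega> x * M x $ p $ q) * (indicator U x * f x)" for x
    using U by (auto simp: indicator_def)
  show ?thesis
    unfolding eq
  proof (rule Bochner_Integration.integrable_bound)
    show "integrable lebesgue (\<lambda>x. \<bar>C\<bar> * (indicator \<Omega> x * M x $ p $ q))"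
      using I by simp
    show "(\<lambda>x. (indicator \<Omega> x * M x $ p $ q) * (indicator U x * f x))
        \<in> borel_measurable lebesgue"
      using borel_measurable_times[OF borel_measurable_integrable[OF I] meas] .
    have "\<bar>indicator U x * f x\<bar> \<le> \<bar>C\<bar>" for x
    proof (cases "x \<in> U")
      case True
      then show ?thesis using C[of x] closure_subset by fastforce
    qed simp
    moreover have "\<bar>a * b\<bar> \<le> \<bar>\<bar>C\<bar> * a\<bar>" if "\<bar>b\<bar> \<le> \<bar>C\<bar>" for a b :: real
      using mult_left_mono[OF that abs_ge_zero[of a]] by (simp add: abs_mult mult.commute)
    ultimately show "AE x in lebesgue. norm ((indicator \<Omega> x * M x $ p $ q) * (indicator U x * f x))
        \<le> norm (\<bar>C\<bar> * (indicator \<Omega> x * M x $ p $ q))"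
      by simp
  qed
qed

lemma matrix_form_expand:
  fixes A :: "real^'d^'d"
  shows "(A *v y) \<bullet> z = (\<Sum>p\<in>UNIV. \<Sum>q\<in>UNIV. A $ p $ q * y $ q * z $ p)"
  by (simp add: inner_vec_def matrix_vector_mult_def sum_distrib_right)

lemma sum_pull_inner:
  "(\<Sum>p\<in>P. \<Sum>q\<in>Q. \<Sum>i\<in>I. f p q i) = (\<Sum>i\<in>I. \<Sum>p\<in>P. \<Sum>q\<in>Q. f p q i)"
proof -
  have "(\<Sum>p\<in>P. \<Sum>q\<in>Q. \<Sum>i\<in>I. f p q i) = (\<Sum>p\<in>P. \<Sum>i\<in>I. \<Sum>q\<in>Q. f p q i)"
    by (intro sum.cong refl sum.swap)
  also have "\<dots> = (\<Sum>i\<in>I. \<Sum>p\<in>P. \<Sum>q\<in>Q. f p q i)"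
    by (rule sum.swap)
  finally show ?thesis .
qed

lemma sum_swap_pairs:
  "(\<Sum>p\<in>P. \<Sum>q\<in>Q. \<Sum>r\<in>I. \<Sum>s\<in>J. f p q r s) = (\<Sum>r\<in>I. \<Sum>s\<in>J. \<Sum>p\<in>P. \<Sum>q\<in>Q. f p q r s)"
proof -
  have "(\<Sum>p\<in>P. \<Sum>q\<in>Q. \<Sum>r\<in>I. \<Sum>s\<in>J. f p q r s) = (\<Sum>p\<in>P. \<Sum>r\<in>I. \<Sum>s\<in>J. \<Sum>q\<in>Q. f p q r s)"
    by (intro sum.cong refl sum_pull_inner[symmetric])
  also have "\<dots> = (\<Sum>r\<in>I. \<Sum>s\<in>J. \<Sum>p\<in>P. \<Sum>q\<in>Q. f p q r s)"
    by (rule sum_pull_inner[symmetric])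
  finally show ?thesis .
qed

text \<open>
  The key identity: a product of two first derivatives of shape functions has degree at most
  \<open>2 * k - 2\<close>, so it coincides with its interpolant in the double-grid space. Its nodal values are
  products of entries of \<open>B\<close>, both taken at the same node; this is why the tensor is diagonal in \<open>i, j\<close>.
\<close>

lemma derivative_product_interpolation:
  fixes \<phi>hatW :: "'wt::finite \<Rightarrow> real^'d \<Rightarrow> real"
    and \<phi>hatV :: "'vt::finite \<Rightarrow> real^'d \<Rightarrow> real"
  assumes W: "reference_lagrange That (2 * k - 2) \<phi>hatW xhatW"
    and V: "\<And>l. \<phi>hatV l \<in> poly_space k"
  shows "partial_deriv s (\<phi>hatV l) \<xi> * partial_deriv r (\<phi>hatV m) \<xi>
    = (\<Sum>i\<in>UNIV. dogip_B \<phi>hatV xhatW $ s $ i $ l * dogip_B \<phi>hatV xhatW $ r $ i $ m * \<phi>hatW i \<xi>)"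
proof -
  have "(\<lambda>\<xi>. partial_deriv s (\<phi>hatV l) \<xi> * partial_deriv r (\<phi>hatV m) \<xi>)
      \<in> poly_space ((k - 1) + (k - 1))"
    using poly_space_derivative[OF V] by (intro poly_space_mult) auto
  also have "(k - 1) + (k - 1) = 2 * k - 2" by simp
  finally show ?thesis
    using nodal_interpolation[OF W] by (auto simp: dogip_B_def)
qed

text \<open>
  The tensor integrates over the closed element. On the facets of \<open>T\<close> the representatives of broken
  functions are zero, because a facet point of \<open>T\<close> is interior to no element at all; so only the
  interior contributes, and there the basis function is a pulled-back shape function.
\<close>

lemma broken_basis_on_element:
  fixes \<Omega> :: "(real^'d) set"
  assumes mesh: "conforming_mesh \<Omega> \<M>" and T: "T \<in> \<M>"
    and W: "lagrange_basis \<M> R S \<phi>hatW xhatW (broken_pw_poly \<M> n) \<phi>W xW locW"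
  shows "indicator T x * \<phi>W (locW T i) x
    = (indicator (interior T) x :: real) * \<phi>hatW i (inv (affine_map (R T) (S T)) x)"
proof (cases "x \<in> T \<and> x \<notin> interior T")
  case True
  have "x \<notin> (\<Union>T\<in>\<M>. interior T)"
    using conforming_mesh_interior_meets[OF mesh T] True by blast
  moreover have "\<phi>W (locW T i) \<in> broken_pw_poly \<M> n"
    using W funsp.span_base[of "\<phi>W (locW T i)" "range \<phi>W"]
    by (auto simp: lagrange_basis_def basis_family_def)
  ultimately show ?thesis using True by (simp add: broken_pw_poly_def)
next
  case False
  then show ?thesis
    using W T interior_subset[of T] by (auto simp: lagrange_basis_def indicator_def)
qed

text \<open>
  Expanding both gradients by the chain rule and the resulting derivative product by
  \<open>derivative_product_interpolation\<close> leaves a finite combination of the weights \<open>w p q i\<close>, whose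
  integrals are those in the tensor. The claim includes integrability, so that the element integrals
  can later be added up.
\<close>

lemma element_stiffness:
  fixes \<Omega> :: "(real^'d) set" and M :: "real^'d \<Rightarrow> real^'d^'d"
    and \<phi>hatV :: "'vt::finite \<Rightarrow> real^'d \<Rightarrow> real" and \<phi>V :: "'v::finite \<Rightarrow> real^'d \<Rightarrow> real"
    and \<phi>hatW :: "'wt::finite \<Rightarrow> real^'d \<Rightarrow> real" and xhatW :: "'wt \<Rightarrow> real^'d"
    and \<phi>W :: "'w::finite \<Rightarrow> real^'d \<Rightarrow> real"
  defines "B \<equiv> dogip_B \<phi>hatV xhatW"
  assumes mesh: "conforming_mesh \<Omega> \<M>" and T: "T \<in> \<M>"
    and maps: "affine_mesh_maps \<M> That R S"
    and refV: "reference_lagrange That k \<phi>hatV xhatV"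
    and V: "lagrange_basis \<M> R S \<phi>hatV xhatV X \<phi>V xV locV"
    and refW: "reference_lagrange That (2 * k - 2) \<phi>hatW xhatW"
    and W: "lagrange_basis \<M> R S \<phi>hatW xhatW (broken_pw_poly \<M> n) \<phi>W xW locW"
    and M: "set_integrable lebesgue \<Omega> M"
  shows "has_bochner_integral lebesgue
     (\<lambda>x. indicator (interior T) x *
        ((M x *v elem_grad \<M> (\<phi>V (locV T l)) x) \<bullet> elem_grad \<M> (\<phi>V (locV T m)) x))
     (\<Sum>r\<in>UNIV. \<Sum>s\<in>UNIV. \<Sum>i\<in>UNIV. \<Sum>j\<in>UNIV.
        dogip_tensor R M \<phi>W locW T $ r $ s $ i $ j * B $ s $ j $ l * B $ r $ i $ m)"
proof -
  let ?G = "inv (affine_map (R T) (S T))"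
  let ?J = "matrix_inv (R T)"
  \<comment> \<open>\<open>w p q i\<close> is the integrand of the tensor, written on the interior of \<open>T\<close>.\<close>
  define w where "w p q i x = indicator (interior T) x * (M x $ p $ q * \<phi>hatW i (?G x))" for p q i x
  have inv: "invertible (R T)" using maps T by (simp add: affine_mesh_maps_def)
  have span: "\<phi>hat i \<in> poly_space n'" if "reference_lagrange That n' \<phi>hat xhat"
    for \<phi>hat :: "'i \<Rightarrow> real^'d \<Rightarrow> real" and xhat n' i
    using that funsp.span_base[of "\<phi>hat i" "range \<phi>hat"]
    by (auto simp: reference_lagrange_def basis_family_def)
  note Vpoly = span[OF refV] and Wpoly = span[OF refW]
  have w_eq: "w p q i x = indicator T x * (M x $ p $ q * \<phi>W (locW T i) x)" for p q i x
    using broken_basis_on_element[OF mesh T W, of x i]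
    by (simp add: w_def mult.left_commute[of _ "M x $ p $ q"])
  have w_int: "integrable lebesgue (w p q i)" for p q i
    unfolding w_def
  proof (rule integrable_entry_times_continuous[OF M open_interior])
    have "int CARD('d) simplex T" "interior T \<subseteq> \<Omega>" using mesh T by (auto simp: conforming_mesh_def)
    then show "interior T \<subseteq> \<Omega>" "bounded (interior T)"
      using compact_simplex compact_imp_bounded bounded_interior by blast+
    have "continuous_on UNIV ?G"
      unfolding inv_affine_map[OF inv]
      by (rule bounded_linear.continuous_on[OF matrix_vector_mul_bounded_linear])
        (intro continuous_intros)
    then show "continuous_on UNIV (\<lambda>x. \<phi>hatW i (?G x))"
      by (rule continuous_on_compose2[OF poly_space_continuous[OF Wpoly]]) auto
  qed
  have grad: "elem_grad \<M> (\<phi>V (locV T l)) x $ p = (\<Sum>r\<in>UNIV. ?J $ r $ p * partial_deriv r (\<phi>hatV l) (?G x))"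
    if "x \<in> interior T" for x p l
    unfolding elem_grad_interior[OF T that] vec_lambda_beta
    using V T poly_space_derivative[OF Vpoly]
    by (intro partial_deriv_affine_pullback[OF inv _ open_interior that]) (auto simp: lagrange_basis_def)
  have integrand: "indicator (interior T) x *
        ((M x *v elem_grad \<M> (\<phi>V (locV T l)) x) \<bullet> elem_grad \<M> (\<phi>V (locV T m)) x)
      = (\<Sum>r\<in>UNIV. \<Sum>s\<in>UNIV. \<Sum>i\<in>UNIV. (\<Sum>p\<in>UNIV. \<Sum>q\<in>UNIV. ?J $ r $ p * ?J $ s $ q * w p q i x)
          * B $ s $ i $ l * B $ r $ i $ m)" for x
  proof (cases "x \<in> interior T")
    case True
    let ?D = "\<lambda>s l. partial_deriv s (\<phi>hatV l) (?G x)"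
    have prod: "?D s l * ?D r m
        = (\<Sum>i\<in>UNIV. B $ s $ i $ l * B $ r $ i $ m * \<phi>hatW i (?G x))" for r s l m
      unfolding B_def by (rule derivative_product_interpolation[OF refW Vpoly])
    have "(M x *v elem_grad \<M> (\<phi>V (locV T l)) x) \<bullet> elem_grad \<M> (\<phi>V (locV T m)) x
      = (\<Sum>p\<in>UNIV. \<Sum>q\<in>UNIV. M x $ p $ q * (\<Sum>r\<in>UNIV. ?J $ r $ p * ?D r m) * (\<Sum>s\<in>UNIV. ?J $ s $ q * ?D s l))"
      by (simp add: matrix_form_expand grad[OF True] mult_ac)
    also have "\<dots> = (\<Sum>p\<in>UNIV. \<Sum>q\<in>UNIV. \<Sum>r\<in>UNIV. \<Sum>s\<in>UNIV. ?J $ r $ p * ?J $ s $ q * M x $ p $ q * (?D s l * ?D r m))"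
      by (simp add: sum_distrib_left sum_distrib_right mult_ac)
    also have "\<dots> = (\<Sum>r\<in>UNIV. \<Sum>s\<in>UNIV. \<Sum>p\<in>UNIV. \<Sum>q\<in>UNIV. ?J $ r $ p * ?J $ s $ q * M x $ p $ q * (?D s l * ?D r m))"
      by (rule sum_swap_pairs)
    also have "\<dots> = (\<Sum>r\<in>UNIV. \<Sum>s\<in>UNIV. \<Sum>p\<in>UNIV. \<Sum>q\<in>UNIV. \<Sum>i\<in>UNIV.
        ?J $ r $ p * ?J $ s $ q * w p q i x * B $ s $ i $ l * B $ r $ i $ m)"
      using True by (simp only: prod, simp add: w_def sum_distrib_left mult_ac)
    also have "\<dots> = (\<Sum>r\<in>UNIV. \<Sum>s\<in>UNIV. \<Sum>i\<in>UNIV. \<Sum>p\<in>UNIV. \<Sum>q\<in>UNIV.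
        ?J $ r $ p * ?J $ s $ q * w p q i x * B $ s $ i $ l * B $ r $ i $ m)"
      by (intro sum.cong refl sum_pull_inner)
    finally show ?thesis using True by (simp add: sum_distrib_right)
  qed (simp add: w_def)
  have tensor: "dogip_tensor R M \<phi>W locW T $ r $ s $ i $ j
      = (if i = j then (\<Sum>p\<in>UNIV. \<Sum>q\<in>UNIV. ?J $ r $ p * ?J $ s $ q * integral\<^sup>L lebesgue (w p q i)) else 0)"
    for r s i j
    by (simp add: dogip_tensor_def set_lebesgue_integral_def w_eq[abs_def])
  have "has_bochner_integral lebesgue
     (\<lambda>x. \<Sum>r\<in>UNIV. \<Sum>s\<in>UNIV. \<Sum>i\<in>UNIV. (\<Sum>p\<in>UNIV. \<Sum>q\<in>UNIV. ?J $ r $ p * ?J $ s $ q * w p q i x)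
          * B $ s $ i $ l * B $ r $ i $ m)
     (\<Sum>r\<in>UNIV. \<Sum>s\<in>UNIV. \<Sum>i\<in>UNIV. (\<Sum>p\<in>UNIV. \<Sum>q\<in>UNIV. ?J $ r $ p * ?J $ s $ q * integral\<^sup>L lebesgue (w p q i))
          * B $ s $ i $ l * B $ r $ i $ m)"
    by (intro has_bochner_integral_sum has_bochner_integral_mult_left has_bochner_integral_mult_right
        has_bochner_integral_integrable w_int)
  then show ?thesis
    unfolding integrand tensor by (simp add: if_distrib[of "\<lambda>c. c * _"] cong: if_cong)
qed

section \<open>Assembly of the element contributions\<close>

text \<open>
  Additivity over the elements needs each element contribution to be integrable, hence the
  Bochner-integral form of the hypothesis.
\<close>

lemma system_matrix_eq_sum_elements:
  fixes \<Omega> :: "(real^'d) set"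
  assumes mesh: "conforming_mesh \<Omega> \<M>"
    and I: "\<And>T. T \<in> \<M> \<Longrightarrow> has_bochner_integral lebesgue
       (\<lambda>x. indicator (interior T) x * ((M x *v elem_grad \<M> (\<phi> j) x) \<bullet> elem_grad \<M> (\<phi> i) x)) (a T)"
  shows "system_matrix \<Omega> \<M> M \<phi> $ i $ j = (\<Sum>T\<in>\<M>. a T)"
proof -
  let ?f = "\<lambda>x. (M x *v elem_grad \<M> (\<phi> j) x) \<bullet> elem_grad \<M> (\<phi> i) x"
  have "(\<lambda>x. indicator \<Omega> x * ?f x) = (\<lambda>x. \<Sum>T\<in>\<M>. indicator (interior T) x * ?f x)"
    by (rule ext, rule indicator_region_eq_sum_interiors[OF mesh]) (simp add: elem_grad_def)
  moreover have "has_bochner_integral lebesgue (\<lambda>x. \<Sum>T\<in>\<M>. indicator (interior T) x * ?f x) (\<Sum>T\<in>\<M>. a T)"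
    by (rule has_bochner_integral_sum) (rule I)
  ultimately show ?thesis
    by (simp add: system_matrix_def set_lebesgue_integral_def has_bochner_integral_integral_eq)
qed

lemma elem_grad_nonlocal:
  assumes "lagrange_basis \<M> R S \<phi>hat xhat X \<phi> x loc" "T \<in> \<M>" "j \<notin> range (loc T)" "y \<in> interior T"
  shows "elem_grad \<M> (\<phi> j) y = 0"
proof -
  have z: "\<phi> j z = 0" if "z \<in> interior T" for z
    using assms that by (auto simp: lagrange_basis_def)
  have "(\<phi> j has_derivative (\<lambda>_. 0)) (at y)"
    by (rule has_derivative_transform_within_open[OF has_derivative_const open_interior assms(4)])
      (simp add: z)
  then show ?thesis
    by (simp add: elem_grad_interior[OF assms(2,4)] partial_deriv_eq vec_eq_iff)
qed

text \<open>
  Turns sums over global degrees of freedom into sums over the local ones of an element.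
\<close>

lemma sum_extend_by_zero:
  fixes f :: "'v::finite \<Rightarrow> real" and loc :: "'vt::finite \<Rightarrow> 'v"
  assumes "inj loc" "\<And>i. i \<notin> range loc \<Longrightarrow> f i = 0"
  shows "(\<Sum>i\<in>UNIV. f i) = (\<Sum>m\<in>UNIV. f (loc m))"
proof -
  have "(\<Sum>i\<in>UNIV. f i) = (\<Sum>i\<in>range loc. f i)"
    by (rule sum.mono_neutral_right) (use assms in auto)
  then show ?thesis using assms(1) by (simp add: sum.reindex)
qed

lemma linear_apply_B: "linear (apply_B B)"
  by (rule linearI)
    (simp_all add: apply_B_def vec_eq_iff sum.distrib sum_distrib_left algebra_simps)

text \<open>
  Moving the adjoint to the other side turns the element form into \<open>A (B u) \<bullet> B v\<close>, which is then
  written out in coordinates.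
\<close>

lemma dogip_form_expand:
  "adjoint (apply_B B) (apply_A A (apply_B B u)) \<bullet> v =
     (\<Sum>r\<in>UNIV. \<Sum>s\<in>UNIV. \<Sum>i\<in>UNIV. \<Sum>j\<in>UNIV. \<Sum>k\<in>UNIV. \<Sum>l\<in>UNIV.
        A $ r $ s $ i $ j * B $ s $ j $ l * u $ l * B $ r $ i $ k * v $ k)"
proof -
  have "adjoint (apply_B B) (apply_A A (apply_B B u)) \<bullet> v = apply_A A (apply_B B u) \<bullet> apply_B B v"
    using adjoint_works[OF linear_apply_B, of v B] by (simp add: inner_commute)
  also have "\<dots> = (\<Sum>r\<in>UNIV. \<Sum>i\<in>UNIV. \<Sum>s\<in>UNIV. \<Sum>j\<in>UNIV.
        A $ r $ s $ i $ j * (\<Sum>l\<in>UNIV. B $ s $ j $ l * u $ l) * (\<Sum>k\<in>UNIV. B $ r $ i $ k * v $ k))"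
    by (simp add: inner_vec_def apply_A_def apply_B_def sum_distrib_right)
  also have "\<dots> = (\<Sum>r\<in>UNIV. \<Sum>i\<in>UNIV. \<Sum>s\<in>UNIV. \<Sum>j\<in>UNIV. \<Sum>k\<in>UNIV. \<Sum>l\<in>UNIV.
        A $ r $ s $ i $ j * B $ s $ j $ l * u $ l * B $ r $ i $ k * v $ k)"
    by (simp only: sum_distrib_left, simp only: sum_distrib_right mult.assoc)
  also have "\<dots> = (\<Sum>r\<in>UNIV. \<Sum>s\<in>UNIV. \<Sum>i\<in>UNIV. \<Sum>j\<in>UNIV. \<Sum>k\<in>UNIV. \<Sum>l\<in>UNIV.
        A $ r $ s $ i $ j * B $ s $ j $ l * u $ l * B $ r $ i $ k * v $ k)"
    by (intro sum.cong refl sum.swap)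
  finally show ?thesis .
qed

theorem theorem10:
  fixes \<Omega> :: "(real^'d) set" and \<M> :: "(real^'d) set set" and k :: nat
    and That :: "(real^'d) set"
    and R :: "(real^'d) set \<Rightarrow> real^'d^'d" and S :: "(real^'d) set \<Rightarrow> real^'d"
    and M :: "real^'d \<Rightarrow> real^'d^'d"
    and \<phi>hatV :: "'vt::finite \<Rightarrow> real^'d \<Rightarrow> real" and xhatV :: "'vt \<Rightarrow> real^'d"
    and \<phi>V :: "'v::finite \<Rightarrow> real^'d \<Rightarrow> real" and xV :: "'v \<Rightarrow> real^'d"
    and locV :: "(real^'d) set \<Rightarrow> 'vt \<Rightarrow> 'v"
    and \<phi>hatW :: "'wt::finite \<Rightarrow> real^'d \<Rightarrow> real" and xhatW :: "'wt \<Rightarrow> real^'d"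
    and \<phi>W :: "'w::finite \<Rightarrow> real^'d \<Rightarrow> real" and xW :: "'w \<Rightarrow> real^'d"
    and locW :: "(real^'d) set \<Rightarrow> 'wt \<Rightarrow> 'w"
    and u v :: "real^'v"
  defines "A \<equiv> system_matrix \<Omega> \<M> M \<phi>V"
    and "AT \<equiv> dogip_tensor R M \<phi>W locW"
    and "B \<equiv> dogip_B \<phi>hatV xhatW"
    and "uT \<equiv> (\<lambda>T. local_dofs locV T u)"
    and "vT \<equiv> (\<lambda>T. local_dofs locV T v)"
  assumes "CARD('d) = 2 \<or> CARD('d) = 3"
    and "open \<Omega>" and "bounded \<Omega>"
    and "conforming_mesh \<Omega> \<M>"
    and "k \<ge> 1"
    and "affine_mesh_maps \<M> That R S"
    and "reference_lagrange That k \<phi>hatV xhatV"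
    and "lagrange_basis \<M> R S \<phi>hatV xhatV (cont_pw_poly \<Omega> \<M> k) \<phi>V xV locV"
    and "reference_lagrange That (2 * k - 2) \<phi>hatW xhatW"
    and "lagrange_basis \<M> R S \<phi>hatW xhatW (broken_pw_poly \<M> (2 * k - 2)) \<phi>W xW locW"
    and "single_element_support \<M> \<phi>W xW"
    and "set_integrable lebesgue \<Omega> M"
    and "uniformly_posdef_bounded \<Omega> M"
  shows "(A *v u) \<bullet> v =
           (\<Sum>T\<in>\<M>. adjoint (apply_B B) (apply_A (AT T) (apply_B B (uT T))) \<bullet> vT T) \<and>
         (\<forall>T\<in>\<M>. adjoint (apply_B B) (apply_A (AT T) (apply_B B (uT T))) \<bullet> vT T =
           (\<Sum>r\<in>UNIV. \<Sum>s\<in>UNIV. \<Sum>i\<in>UNIV. \<Sum>j\<in>UNIV. \<Sum>k\<in>UNIV. \<Sum>l\<in>UNIV.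
              AT T $ r $ s $ i $ j * B $ s $ j $ l * uT T $ l * B $ r $ i $ k * vT T $ k))"
proof (intro conjI ballI)
  note mesh = \<open>conforming_mesh \<Omega> \<M>\<close>
    and V = \<open>lagrange_basis \<M> R S \<phi>hatV xhatV (cont_pw_poly \<Omega> \<M> k) \<phi>V xV locV\<close>
    and stiffness = element_stiffness[OF mesh _ \<open>affine_mesh_maps \<M> That R S\<close>
      \<open>reference_lagrange That k \<phi>hatV xhatV\<close>
      \<open>lagrange_basis \<M> R S \<phi>hatV xhatV (cont_pw_poly \<Omega> \<M> k) \<phi>V xV locV\<close>
      \<open>reference_lagrange That (2 * k - 2) \<phi>hatW xhatW\<close>
      \<open>lagrange_basis \<M> R S \<phi>hatW xhatW (broken_pw_poly \<M> (2 * k - 2)) \<phi>W xW locW\<close>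
      \<open>set_integrable lebesgue \<Omega> M\<close>]
  define f where "f T i j x = indicator (interior T) x *
    ((M x *v elem_grad \<M> (\<phi>V j) x) \<bullet> elem_grad \<M> (\<phi>V i) x)" for T i j x
  define a where "a T i j = integral\<^sup>L lebesgue (f T i j)" for T i j
  have f_nonlocal: "f T i j = (\<lambda>x. 0)"
    if "T \<in> \<M>" "i \<notin> range (locV T) \<or> j \<notin> range (locV T)" for T i j
  proof
    fix x
    show "f T i j x = 0"
      using that elem_grad_nonlocal[OF V, of T _ x]
      by (cases "x \<in> interior T") (auto simp: f_def)
  qed
  \<comment> \<open>Pairs of indices that are not both local to \<open>T\<close> contribute zero on \<open>T\<close>, so the element
    identity gives integrability for all pairs.\<close>
  have f_int: "has_bochner_integral lebesgue (f T i j) (a T i j)" if T: "T \<in> \<M>" for T i j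
  proof -
    have "integrable lebesgue (f T i j)"
    proof (cases "i \<in> range (locV T) \<and> j \<in> range (locV T)")
      case True
      then obtain l m where "j = locV T l" "i = locV T m" by blast
      then show ?thesis
        using stiffness[OF T, of l m] unfolding f_def has_bochner_integral_iff by simp
    next
      case False
      then show ?thesis using f_nonlocal[OF T, of i j] by simp
    qed
    then show ?thesis unfolding a_def by (rule has_bochner_integral_integrable)
  qed
  have a_local: "a T (locV T m) (locV T l) = (\<Sum>r\<in>UNIV. \<Sum>s\<in>UNIV. \<Sum>i\<in>UNIV. \<Sum>j\<in>UNIV.
      AT T $ r $ s $ i $ j * B $ s $ j $ l * B $ r $ i $ m)" if "T \<in> \<M>" for T l m
    using stiffness[OF that, of l m] unfolding a_def f_def AT_def B_def
    by (simp add: has_bochner_integral_integral_eq)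
  have form: "(\<Sum>i\<in>UNIV. \<Sum>j\<in>UNIV. a T i j * u $ j * v $ i)
      = adjoint (apply_B B) (apply_A (AT T) (apply_B B (uT T))) \<bullet> vT T" if T: "T \<in> \<M>" for T
  proof -
    have inj: "inj (locV T)" using V T by (simp add: lagrange_basis_def)
    have a0: "a T i j = 0" if "i \<notin> range (locV T) \<or> j \<notin> range (locV T)" for i j
      using f_nonlocal[OF T that] by (simp add: a_def)
    have "(\<Sum>i\<in>UNIV. \<Sum>j\<in>UNIV. a T i j * u $ j * v $ i)
        = (\<Sum>m\<in>UNIV. \<Sum>j\<in>UNIV. a T (locV T m) j * u $ j * v $ locV T m)"
      by (rule sum_extend_by_zero[OF inj]) (simp add: a0)
    also have "\<dots> = (\<Sum>m\<in>UNIV. \<Sum>l\<in>UNIV. a T (locV T m) (locV T l) * uT T $ l * vT T $ m)"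
      unfolding uT_def vT_def local_dofs_def vec_lambda_beta
      by (intro sum.cong refl sum_extend_by_zero[OF inj]) (simp add: a0)
    also have "\<dots> = (\<Sum>m\<in>UNIV. \<Sum>l\<in>UNIV. \<Sum>r\<in>UNIV. \<Sum>s\<in>UNIV. \<Sum>i\<in>UNIV. \<Sum>j\<in>UNIV.
        AT T $ r $ s $ i $ j * B $ s $ j $ l * uT T $ l * B $ r $ i $ m * vT T $ m)"
      by (simp add: a_local[OF T] sum_distrib_left sum_distrib_right mult_ac)
    also have "\<dots> = (\<Sum>r\<in>UNIV. \<Sum>s\<in>UNIV. \<Sum>m\<in>UNIV. \<Sum>l\<in>UNIV. \<Sum>i\<in>UNIV. \<Sum>j\<in>UNIV.
        AT T $ r $ s $ i $ j * B $ s $ j $ l * uT T $ l * B $ r $ i $ m * vT T $ m)"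
      by (rule sum_swap_pairs)
    also have "\<dots> = adjoint (apply_B B) (apply_A (AT T) (apply_B B (uT T))) \<bullet> vT T"
      unfolding dogip_form_expand by (intro sum.cong refl sum_swap_pairs)
    finally show ?thesis .
  qed
  have "A $ i $ j = (\<Sum>T\<in>\<M>. a T i j)" for i j
    unfolding A_def by (rule system_matrix_eq_sum_elements[OF mesh f_int[unfolded f_def]])
  then have "(A *v u) \<bullet> v = (\<Sum>i\<in>UNIV. \<Sum>j\<in>UNIV. \<Sum>T\<in>\<M>. a T i j * u $ j * v $ i)"
    by (simp add: inner_vec_def matrix_vector_mult_def sum_distrib_right)
  also have "\<dots> = (\<Sum>T\<in>\<M>. \<Sum>i\<in>UNIV. \<Sum>j\<in>UNIV. a T i j * u $ j * v $ i)"
    by (rule sum_pull_inner)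
  also have "\<dots> = (\<Sum>T\<in>\<M>. adjoint (apply_B B) (apply_A (AT T) (apply_B B (uT T))) \<bullet> vT T)"
    by (intro sum.cong refl form)
  finally show "(A *v u) \<bullet> v
      = (\<Sum>T\<in>\<M>. adjoint (apply_B B) (apply_A (AT T) (apply_B B (uT T))) \<bullet> vT T)" .
qed (rule dogip_form_expand)

end
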